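(* Let $1 \le m \le n$, let $C \in \mathbb{R}^{n\times m}$ have full column rank and let $\widehat{A} \in \mathbb{R}^{n\times n}$ be arbitrary. Define $$P_C := I_n - C\,(C^\top C)^{-1} C^\top, \qquad A^\star := P_C \widehat{A}.$$ Then $A^\star$ is the unique minimiser of the problem $$\min_{M \in \mathbb{R}^{n\times n}} \; \|M - \widehat{A}\|_F \quad \text{subject to} \quad C^\top M = 0,$$ it satisfies $C^\top A^\star = 0$, and $$A^\star - \widehat{A} = -\,C\,(C^\top C)^{-1} C^\top \widehat{A}$$ has rank at most $m$, with $\operatorname{rank}(A^\star - \widehat{A}) = \operatorname{rank}(C^\top \widehat{A})$.
   Context: The Frobenius inner product on $\mathbb{R}^{n\times n}$ is $\langle X,Y\rangle_F := \mathrm{trace}(Y^\top X)$, with associated norm $\|X\|_F := \sqrt{\langle X,X\rangle_F}$. $I_n$ is the identity matrix in $\mathbb{R}^{n\times n}$. Since $C$ has full column rank (rank $m$), the matrix $C^\top C \in \mathbb{R}^{m\times m}$ is invertible, so $P_C$ is well defined. *)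

theory Defs
  imports "HOL-Analysis.Analysis"
begin

definition frob_inner :: "real^'n^'n \<Rightarrow> real^'n^'n \<Rightarrow> real" where
  "frob_inner X Y = trace (transpose Y ** X)"

definition frob_norm :: "real^'n^'n \<Rightarrow> real" where
  "frob_norm X = sqrt (frob_inner X X)"

(* An n x m matrix has type real^'m^'n, with n = CARD('n) and m = CARD('m).
   matrix_inv is unspecified on singular matrices; gram_invertible below shows
   that it is the genuine inverse here when C has full column rank. *)
definition proj_compl :: "real^'m^'n \<Rightarrow> real^'n^'n" where
  "proj_compl C = mat 1 - C ** matrix_inv (transpose C ** C) ** transpose C"

definition A_star :: "real^'m^'n \<Rightarrow> real^'n^'n \<Rightarrow> real^'n^'n" where
  "A_star C A = proj_compl C ** A"

lemma gram_invertible: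
  fixes C :: "real^'m^'n"
  assumes "rank C = CARD('m)"
  shows "invertible (transpose C ** C)"
proof -
  have inj: "inj ((*v) C)"
    using assms by (simp add: full_rank_injective)
  have "x = 0" if "(transpose C ** C) *v x = 0" for x
  proof -
    have "(C *v x) \<bullet> (C *v x) = x \<bullet> ((transpose C ** C) *v x)"
      by (metis dot_lmul_matrix inner_commute matrix_vector_mul_assoc
          transpose_matrix_vector transpose_transpose)
    then have "C *v x = 0"
      using that by simp
    then show "x = 0"
      using inj by (metis injD matrix_vector_mult_0_right)
  qed
  then show ?thesis
    by (simp add: invertible_left_inverse matrix_left_invertible_ker)
qed

end

theory Submission
  imports Defs
begin

text \<open>
  The Frobenius inner product is the Euclidean inner product of \<open>\<real>\<^sup>n\<^sup>\<times>\<^sup>n\<close>. The difference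
  \<open>A\<^sup>\<star> - A\<close> has the form \<open>C Z\<close>, which is orthogonal to every \<open>D\<close> with \<open>C\<^sup>T D = 0\<close>; so
  Pythagoras gives \<open>\<parallel>M - A\<parallel>\<^sup>2 = \<parallel>M - A\<^sup>\<star>\<parallel>\<^sup>2 + \<parallel>A\<^sup>\<star> - A\<parallel>\<^sup>2\<close> for every feasible \<open>M\<close>.
  For the ranks, \<open>A\<^sup>\<star> - A\<close> and \<open>C\<^sup>T A\<close> are left multiples of each other, since
  \<open>C\<^sup>T (A\<^sup>\<star> - A) = - C\<^sup>T A\<close>.
\<close>

lemma trace_transpose_mult:
  fixes X Y :: "real^'n^'m"
  shows "trace (transpose Y ** X) = X \<bullet> Y"
proof -
  have "trace (transpose Y ** X) = (\<Sum>i\<in>UNIV. \<Sum>k\<in>UNIV. X $ k $ i * Y $ k $ i)"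
    by (simp add: trace_def matrix_matrix_mult_def transpose_def mult.commute)
  also have "\<dots> = X \<bullet> Y"
    by (subst sum.swap) (simp add: inner_vec_def)
  finally show ?thesis .
qed

lemma frob_norm_eq_norm: "frob_norm X = norm X"
  by (simp add: frob_norm_def frob_inner_def trace_transpose_mult norm_eq_sqrt_inner)

text \<open>The adjoint of left multiplication by \<open>C\<close> is left multiplication by
  \<open>transpose C\<close>, so the inner product equals that of \<open>transpose C ** D\<close>
  with \<open>Z\<close>.\<close>

lemma inner_matrix_mult_eq_0:
  fixes C :: "real^'m^'n" and D :: "real^'k^'n"
  assumes "transpose C ** D = 0"
  shows "D \<bullet> (C ** Z) = 0"
proof -
  have "D \<bullet> (C ** Z) = trace (transpose (C ** Z) ** D)"
    by (simp add: trace_transpose_mult)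
  also have "\<dots> = trace (transpose Z ** (transpose C ** D))"
    by (simp add: matrix_transpose_mul matrix_mul_assoc)
  finally show ?thesis
    by (simp add: assms trace_def)
qed

text \<open>The squared distance from \<open>x\<close> to \<open>a\<close> exceeds that from
  \<open>p\<close> by exactly \<open>(norm (x - p))\<^sup>2\<close>, which yields minimality and
  uniqueness together.\<close>

lemma is_arg_min_norm_iff_orthogonal:
  fixes a p :: "'a::real_inner"
  assumes "P p" and orth: "\<And>x. P x \<Longrightarrow> (x - p) \<bullet> (p - a) = 0"
  shows "is_arg_min (\<lambda>x. norm (x - a)) P x \<longleftrightarrow> x = p"
proof -
  have pyth: "(norm (x - a))\<^sup>2 = (norm (x - p))\<^sup>2 + (norm (p - a))\<^sup>2" if "P x" for x
    using norm_add_Pythagorean[of "x - p" "p - a"] orth[OF that]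
    by (simp add: orthogonal_def)
  have ge: "norm (p - a) \<le> norm (x - a)" if "P x" for x
    using pyth[OF that] by (simp add: power2_le_imp_le)
  have "x = p" if "P x" "norm (x - a) = norm (p - a)" for x
    using pyth[OF that(1)] that(2) by simp
  moreover have "norm (x - a) = norm (p - a)" if "is_arg_min (\<lambda>x. norm (x - a)) P x"
    using that \<open>P p\<close> ge by (auto simp: is_arg_min_linorder intro: antisym)
  ultimately show ?thesis
    using \<open>P p\<close> ge by (auto simp: is_arg_min_linorder)
qed

lemma invertible_matrix_inv:
  assumes "invertible G"
  shows "G ** matrix_inv G = mat 1" "matrix_inv G ** G = mat 1"
  using someI_ex[OF assms[unfolded invertible_def]] by (simp_all add: matrix_inv_def)

lemma matrix_diff_rdistrib:
  fixes X Y :: "'a::ring_1^'m^'n"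
  shows "(X - Y) ** Z = X ** Z - Y ** Z"
  by (simp add: matrix_matrix_mult_def vec_eq_iff left_diff_distrib sum_subtractf)

lemma matrix_diff_ldistrib:
  fixes X :: "'a::ring_1^'m^'n"
  shows "X ** (Y - Z) = X ** Y - X ** Z"
  by (simp add: matrix_matrix_mult_def vec_eq_iff right_diff_distrib sum_subtractf)

lemma matrix_mult_minus_left:
  fixes X :: "'a::ring_1^'m^'n"
  shows "(- X) ** Y = - (X ** Y)"
  by (simp add: matrix_matrix_mult_def vec_eq_iff sum_negf)

lemma matrix_mult_minus_right:
  fixes X :: "'a::ring_1^'m^'n"
  shows "X ** (- Y) = - (X ** Y)"
  by (simp add: matrix_matrix_mult_def vec_eq_iff sum_negf)

lemma A_star_diff:
  "A_star C A - A = - (C ** matrix_inv (transpose C ** C) ** transpose C ** A)"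
  by (simp add: A_star_def proj_compl_def matrix_diff_rdistrib)

text \<open>The Gram matrix cancels its inverse. This gives both feasibility of
  \<open>A_star C A\<close> and the lower bound on the rank.\<close>

lemma transpose_mult_A_star_diff:
  fixes C :: "real^'m^'n"
  assumes "rank C = CARD('m)"
  shows "transpose C ** (A_star C A - A) = - (transpose C ** A)"
proof -
  let ?G = "transpose C ** C"
  have "transpose C ** (A_star C A - A) = - (?G ** matrix_inv ?G ** (transpose C ** A))"
    by (simp add: A_star_diff matrix_mult_minus_right matrix_mul_assoc)
  then show ?thesis
    by (simp add: invertible_matrix_inv[OF gram_invertible[OF assms]])
qed

theorem proposition1:
  fixes C :: "real^'m^'n" and A :: "real^'n^'n"
  assumes "CARD('m) \<le> CARD('n)"
    and "rank C = CARD('m)"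
  shows "(\<forall>M. is_arg_min (\<lambda>M. frob_norm (M - A)) (\<lambda>M. transpose C ** M = 0) M
                \<longleftrightarrow> M = A_star C A)
    \<and> transpose C ** A_star C A = 0
    \<and> A_star C A - A = - (C ** matrix_inv (transpose C ** C) ** transpose C ** A)
    \<and> rank (A_star C A - A) \<le> CARD('m)
    \<and> rank (A_star C A - A) = rank (transpose C ** A)"
proof -
  define W where "W = matrix_inv (transpose C ** C)"
  \<comment> \<open>Two factorisations of one matrix: \<open>C\<close> on the left serves
    orthogonality and the bound by \<open>CARD('m)\<close>; \<open>transpose C ** A\<close> on the
    right serves the comparison of ranks.\<close>
  have diff: "A_star C A - A = C ** (- (W ** transpose C ** A))"
    by (simp add: A_star_diff W_def matrix_mult_minus_right matrix_mul_assoc)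
  have diff': "A_star C A - A = (- (C ** W)) ** (transpose C ** A)"
    by (simp add: A_star_diff W_def matrix_mult_minus_left matrix_mul_assoc)
  note mult_diff = transpose_mult_A_star_diff[OF assms(2)]
  have feasible: "transpose C ** A_star C A = 0"
    using mult_diff[of A] by (simp add: matrix_diff_ldistrib)
  have "is_arg_min (\<lambda>M. norm (M - A)) (\<lambda>M. transpose C ** M = 0) M \<longleftrightarrow> M = A_star C A" for M
  proof (rule is_arg_min_norm_iff_orthogonal)
    show "transpose C ** A_star C A = 0" by (fact feasible)
  next
    fix N :: "real^'n^'n" assume "transpose C ** N = 0"
    then have "transpose C ** (N - A_star C A) = 0"
      using feasible by (simp add: matrix_diff_ldistrib)
    then show "(N - A_star C A) \<bullet> (A_star C A - A) = 0"
      unfolding diff by (rule inner_matrix_mult_eq_0)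
  qed
  moreover have "rank (A_star C A - A) \<le> CARD('m)"
    using rank_mul_le_left[of C "- (W ** transpose C ** A)"] assms(2) by (simp add: diff)
  moreover have "rank (A_star C A - A) = rank (transpose C ** A)"
  proof (rule antisym)
    show "rank (A_star C A - A) \<le> rank (transpose C ** A)"
      unfolding diff' by (rule rank_mul_le_right)
    \<comment> \<open>The sign is absorbed into the left factor, so that
      \<open>transpose C ** A\<close> itself is a left multiple of the difference.\<close>
    have "rank (transpose C ** A) = rank ((- transpose C) ** (A_star C A - A))"
      by (simp only: matrix_mult_minus_left mult_diff minus_minus)
    also have "\<dots> \<le> rank (A_star C A - A)"
      by (rule rank_mul_le_right)
    finally show "rank (transpose C ** A) \<le> rank (A_star C A - A)" .
  qed
  ultimately show ?thesis
    using feasible A_star_diff by (simp add: frob_norm_eq_norm)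
qed

end
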